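(* Let $I(\boldsymbol{B},\boldsymbol{r})$ be a diagonal blockwise determinantal ideal with $\boldsymbol{B}=(B_1,\dots,B_k)$, $\boldsymbol{r}=(r_1,\dots,r_k)$, let $\mathcal{G}$ be its generating set (the set of all $r_i$-minors in $B_i$ for all $i$), and suppose that $\mathcal{G}$ is a Gröbner basis of $I(\boldsymbol{B},\boldsymbol{r})$ with respect to a diagonal term order. For $\boldsymbol{m}\in\mathcal{G}$ let $\boldsymbol{B}_{\boldsymbol{m}}=\{B_i : r_i=\deg(\boldsymbol{m})\}$. Then: (1) If for each $\boldsymbol{m}\in\mathcal{G}$ we have $l_d(\mathrm{lt}(\boldsymbol{m}),\tilde B)<\tilde r$ for every block $\tilde B\in\boldsymbol{B}\setminus\boldsymbol{B}_{\boldsymbol{m}}$, where $\tilde r$ is the size of the minors in $\tilde B$, then $\mathcal{G}$ is a minimal Gröbner basis of $I(\boldsymbol{B},\boldsymbol{r})$. (2) If for each $\boldsymbol{m}\in\mathcal{G}$ and each term $\boldsymbol{t}$ of $\boldsymbol{m}$ we have $l_d(\boldsymbol{t},\tilde B)<\tilde r$ for every block $\tilde B\in\boldsymbol{B}\setminus\boldsymbol{B}_{\boldsymbol{m}}$, then $\mathcal{G}$ is the reduced Gröbner basis of $I(\boldsymbol{B},\boldsymbol{r})$.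
   Context: Let $K$ be a field and $X=(x_{ij})$ a generic $m\times n$ matrix ($m\le n$) of distinct variables; $K[\boldsymbol{x}]$ is the polynomial ring in all $mn$ variables. A subset of $X$ means a set of entries. An $r$-minor of $X$ is the determinant of an $r\times r$ submatrix (arbitrary row and column index sets of size $r$), regarded as a polynomial; it is a minor in a subset $B$ if all entries of the submatrix belong to $B$. A term is a monomial; a term of a polynomial is a monomial appearing with nonzero coefficient; $\mathrm{lt}$ and $\mathrm{lc}$ denote leading term (monomial) and leading coefficient. A term order is diagonal if the leading term of every minor of $X$ is the product of the diagonal entries of the corresponding submatrix. A non-empty subset $B$ of $X$ is diagonal if whenever $x_{pq},x_{\tilde p\tilde q}\in B$ with $p\le\tilde p$, $q\le\tilde q$, all $x_{ij}$ with $p\le i\le\tilde p$, $q\le j\le\tilde q$ belong to $B$. For a sequence $\boldsymbol{B}=(B_1,\dots,B_k)$ of non-empty subsets of $X$ (blocks) and a sequence $\boldsymbol{r}=(r_1,\dots,r_k)$ of positive integers, the blockwise determinantal ideal $I(\boldsymbol{B},\boldsymbol{r})\subseteq K[\boldsymbol{x}]$ is generated by all $r_i$-minors in $B_i$ for all $i$; it is diagonal when all blocks are diagonal. Blocks are understood together with their associated minor sizes, so $\boldsymbol{B}\setminus\boldsymbol{B}_{\boldsymbol{m}}$ consists of the $B_j$ with $r_j\ne\deg(\boldsymbol{m})$. A term $\boldsymbol{t}$ of a minor is a product $\prod_{k=1}^r x_{i_kj_k}$ of entries from distinct rows and columns, written with $i_1<\cdots<i_r$. For a subset $B$ of $X$,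 keep only the pairs $(i_k,j_k)$ with $x_{i_kj_k}\in B$, in increasing order of $i_k$; the diagonal length $l_d(\boldsymbol{t},B)$ is the length of the longest increasing subsequence of the resulting sequence of column indices. A Gröbner basis $\mathcal{G}$ is minimal if for each $G\in\mathcal{G}$, $\mathrm{lt}(G)$ is not divisible by the leading term of any other element of $\mathcal{G}$ and $\mathrm{lc}(G)=\pm1$. It is reduced if for each $G\in\mathcal{G}$ no term of $G$ is divisible by the leading term of an element of $\mathcal{G}\setminus\{G\}$, and $\mathrm{lc}(G)=\pm1$ (unique up to signs). *)

theory Defs
  imports "HOL-Library.Cardinality" "HOL-Library.Poly_Mapping" "Jordan_Normal_Form.Determinant"
begin

section \<open>The polynomial ring of a generic matrix\<close>

text \<open>The rows and columns of the generic matrix are indexed by finite linearly ordered types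
  \<open>'m\<close> and \<open>'n\<close>; an entry \<open>x\<^sub>i\<^sub>j\<close> is identified with the pair \<open>(i, j)\<close>, so a subset of the matrix
  is a set of pairs. A term is an exponent vector (written additively), and a polynomial maps
  terms to coefficients with finite support.\<close>

type_synonym ('m, 'n) mterm = "('m \<times> 'n) \<Rightarrow>\<^sub>0 nat"
type_synonym ('m, 'n, 'k) gpoly = "('m, 'n) mterm \<Rightarrow>\<^sub>0 'k"

definition var_term :: "'m \<Rightarrow> 'n \<Rightarrow> ('m, 'n) mterm" where
  "var_term i j = Poly_Mapping.single (i, j) 1"

definition var :: "'m \<Rightarrow> 'n \<Rightarrow> ('m, 'n, 'k::field) gpoly" where
  "var i j = Poly_Mapping.single (var_term i j) 1"

definition terms :: "('m, 'n, 'k::field) gpoly \<Rightarrow> ('m, 'n) mterm set" where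
  "terms p = Poly_Mapping.keys p"

definition tdvd :: "('m, 'n) mterm \<Rightarrow> ('m, 'n) mterm \<Rightarrow> bool" where
  "tdvd s t \<longleftrightarrow> (\<exists>u. t = s + u)"

definition term_degree :: "('m, 'n) mterm \<Rightarrow> nat" where
  "term_degree t = (\<Sum>v\<in>Poly_Mapping.keys t. Poly_Mapping.lookup t v)"

definition total_degree :: "('m, 'n, 'k::field) gpoly \<Rightarrow> nat" where
  "total_degree p = Max (insert 0 (term_degree ` terms p))"

definition gen_ideal :: "('m, 'n, 'k::field) gpoly set \<Rightarrow> ('m, 'n, 'k) gpoly set" where
  "gen_ideal = Modules.module.span (*)"


section \<open>Minors\<close>

definition minor ::
    "'m::{finite,linorder} set \<Rightarrow> 'n::{finite,linorder} set \<Rightarrow> ('m, 'n, 'k::field) gpoly" where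
  "minor R C = det (mat (card R) (card C)
     (\<lambda>(a, b). var (sorted_list_of_set R ! a) (sorted_list_of_set C ! b)))"

definition diag_term ::
    "'m::{finite,linorder} set \<Rightarrow> 'n::{finite,linorder} set \<Rightarrow> ('m, 'n) mterm" where
  "diag_term R C = (\<Sum>a<card R. var_term (sorted_list_of_set R ! a) (sorted_list_of_set C ! a))"

definition minors_in ::
    "nat \<Rightarrow> ('m::{finite,linorder} \<times> 'n::{finite,linorder}) set \<Rightarrow> ('m, 'n, 'k::field) gpoly set" where
  "minors_in r B = {minor R C | R C. card R = r \<and> card C = r \<and> R \<times> C \<subseteq> B}"


section \<open>Term orders and Groebner bases\<close>

definition term_order :: "(('m, 'n) mterm \<Rightarrow> ('m, 'n) mterm \<Rightarrow> bool) \<Rightarrow> bool" where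
  "term_order tle \<longleftrightarrow>
     reflp tle \<and> transp tle \<and> antisymp tle \<and> totalp tle \<and>
     (\<forall>t. tle 0 t) \<and> (\<forall>s t u. tle s t \<longrightarrow> tle (s + u) (t + u))"

text \<open>Only meaningful for nonzero polynomials; the leading coefficient of \<open>0\<close> is \<open>0\<close>.\<close>

definition lt :: "(('m, 'n) mterm \<Rightarrow> ('m, 'n) mterm \<Rightarrow> bool) \<Rightarrow>
    ('m, 'n, 'k::field) gpoly \<Rightarrow> ('m, 'n) mterm" where
  "lt tle p = (THE t. t \<in> terms p \<and> (\<forall>s\<in>terms p. tle s t))"

definition lc :: "(('m, 'n) mterm \<Rightarrow> ('m, 'n) mterm \<Rightarrow> bool) \<Rightarrow>
    ('m, 'n, 'k::field) gpoly \<Rightarrow> 'k" where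
  "lc tle p = Poly_Mapping.lookup p (lt tle p)"

text \<open>The type argument fixes the coefficient field of the minors under consideration.\<close>

definition diagonal_term_order :: "'k::field itself \<Rightarrow>
    (('m::{finite,linorder}, 'n::{finite,linorder}) mterm \<Rightarrow> ('m, 'n) mterm \<Rightarrow> bool) \<Rightarrow> bool" where
  "diagonal_term_order _ tle \<longleftrightarrow> term_order tle \<and>
     (\<forall>R C. card R = card C \<longrightarrow>
        lt tle (minor R C :: ('m, 'n, 'k) gpoly) = diag_term R C)"

definition initial_ideal :: "(('m, 'n) mterm \<Rightarrow> ('m, 'n) mterm \<Rightarrow> bool) \<Rightarrow>
    ('m, 'n, 'k::field) gpoly set \<Rightarrow> ('m, 'n, 'k) gpoly set" where
  "initial_ideal tle F = gen_ideal {Poly_Mapping.single (lt tle f) 1 | f. f \<in> F \<and> f \<noteq> 0}"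

definition groebner_basis :: "(('m, 'n) mterm \<Rightarrow> ('m, 'n) mterm \<Rightarrow> bool) \<Rightarrow>
    ('m, 'n, 'k::field) gpoly set \<Rightarrow> ('m, 'n, 'k) gpoly set \<Rightarrow> bool" where
  "groebner_basis tle I G \<longleftrightarrow>
     finite G \<and> G \<subseteq> I \<and> initial_ideal tle G = initial_ideal tle I"

definition minimal_groebner_basis :: "(('m, 'n) mterm \<Rightarrow> ('m, 'n) mterm \<Rightarrow> bool) \<Rightarrow>
    ('m, 'n, 'k::field) gpoly set \<Rightarrow> ('m, 'n, 'k) gpoly set \<Rightarrow> bool" where
  "minimal_groebner_basis tle I G \<longleftrightarrow> groebner_basis tle I G \<and>
     (\<forall>g\<in>G. (\<forall>h\<in>G - {g}. \<not> tdvd (lt tle h) (lt tle g)) \<and> lc tle g \<in> {1, -1})"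

definition reduced_groebner_basis :: "(('m, 'n) mterm \<Rightarrow> ('m, 'n) mterm \<Rightarrow> bool) \<Rightarrow>
    ('m, 'n, 'k::field) gpoly set \<Rightarrow> ('m, 'n, 'k) gpoly set \<Rightarrow> bool" where
  "reduced_groebner_basis tle I G \<longleftrightarrow> groebner_basis tle I G \<and>
     (\<forall>g\<in>G. (\<forall>t\<in>terms g. \<forall>h\<in>G - {g}. \<not> tdvd (lt tle h) t) \<and> lc tle g \<in> {1, -1})"


section \<open>Blockwise determinantal ideals\<close>

definition diagonal_block :: "('m::linorder \<times> 'n::linorder) set \<Rightarrow> bool" where
  "diagonal_block B \<longleftrightarrow> B \<noteq> {} \<and>
     (\<forall>p q p' q'. (p, q) \<in> B \<and> (p', q') \<in> B \<and> p \<le> p' \<and> q \<le> q' \<longrightarrow>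
        (\<forall>i j. p \<le> i \<and> i \<le> p' \<and> q \<le> j \<and> j \<le> q' \<longrightarrow> (i, j) \<in> B))"

text \<open>Sequences of blocks and of minor sizes of length \<open>k\<close> are functions on the indices \<open>i < k\<close>.\<close>

definition bdi_gens :: "nat \<Rightarrow> (nat \<Rightarrow> ('m::{finite,linorder} \<times> 'n::{finite,linorder}) set) \<Rightarrow>
    (nat \<Rightarrow> nat) \<Rightarrow> ('m, 'n, 'k::field) gpoly set" where
  "bdi_gens k B r = (\<Union>i<k. minors_in (r i) (B i))"

definition bdi :: "nat \<Rightarrow> (nat \<Rightarrow> ('m::{finite,linorder} \<times> 'n::{finite,linorder}) set) \<Rightarrow>
    (nat \<Rightarrow> nat) \<Rightarrow> ('m, 'n, 'k::field) gpoly set" where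
  "bdi k B r = gen_ideal (bdi_gens k B r)"


section \<open>Diagonal length\<close>

definition longest_increasing :: "'a::linorder list \<Rightarrow> nat" where
  "longest_increasing xs = Max (length ` {ys \<in> set (subseqs xs). sorted_wrt (<) ys})"

text \<open>Intended for products of entries from distinct rows and columns, where sorting the entries
  by their row index is unambiguous.\<close>

definition diagonal_length ::
    "('m::linorder, 'n::linorder) mterm \<Rightarrow> ('m \<times> 'n) set \<Rightarrow> nat" where
  "diagonal_length t B =
     longest_increasing (map snd (sorted_key_list_of_set fst (Poly_Mapping.keys t \<inter> B)))"

end

theory Submission
  imports Defs "HOL-Library.Sublist"
begin

text \<open>
  The Groebner property is a hypothesis, so only divisibilities between terms are at stake. Suppose
  that the leading term of a generator \<open>h = minor R' C'\<close>, a minor in the block \<open>B j\<close> of size \<open>r j\<close>,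
  divides a term \<open>t\<close> of a generator \<open>g = minor R C\<close>. As the term order is diagonal, this leading
  term is the product of the diagonal entries of \<open>R' \<times> C'\<close>. All terms in sight are squarefree, so
  they can be treated as sets of matrix entries: the keys of \<open>t\<close> are the graph of a bijection from
  \<open>R\<close> to \<open>C\<close>, and they include the diagonal of \<open>R' \<times> C'\<close>.

  If \<open>r j\<close> differs from the degree of \<open>g\<close>, that diagonal is a strictly increasing chain of \<open>r j\<close>
  entries of \<open>t\<close> inside \<open>B j\<close>, hence the diagonal length of \<open>t\<close> in \<open>B j\<close> is at least \<open>r j\<close>
  (\<open>card_le_diagonal_length_if_diag_term_dvd\<close>), against the hypothesis on \<open>t\<close>. If \<open>r j\<close> equals the
  degree of \<open>g\<close>, the two sets of entries have the same size and coincide; projecting them to rows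
  and to columns gives \<open>R' = R\<close> and \<open>C' = C\<close>, so \<open>h = g\<close> (\<open>rows_cols_eq_if_diag_term_dvd\<close>).

  Taking \<open>t\<close> to be the leading term of \<open>g\<close> gives minimality, and letting \<open>t\<close> range over all terms
  of \<open>g\<close> gives reducedness. Leading coefficients are \<open>1\<close> because the diagonal term comes from the
  identity permutation only.
\<close>

section \<open>The terms of the Leibniz expansion\<close>

definition perm_term ::
    "'m::{finite,linorder} set \<Rightarrow> 'n::{finite,linorder} set \<Rightarrow> (nat \<Rightarrow> nat) \<Rightarrow> ('m, 'n) mterm" where
  "perm_term R C p =
     (\<Sum>a<card R. var_term (sorted_list_of_set R ! a) (sorted_list_of_set C ! p a))"

lemma diag_term_eq_perm_term_id: "diag_term R C = perm_term R C id"
  by (simp add: diag_term_def perm_term_def)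

lemma lookup_sum_single_inj:
  assumes "finite A" "inj_on f A"
  shows "Poly_Mapping.lookup (\<Sum>a\<in>A. Poly_Mapping.single (f a) (1::nat)) v = of_bool (v \<in> f ` A)"
  using assms
  by (induction A rule: finite_induct) (auto simp: lookup_add lookup_single when_def)

lemma prod_single_one:
  "finite A \<Longrightarrow> (\<Prod>a\<in>A. Poly_Mapping.single (f a) (1::'k::comm_ring_1)) =
     Poly_Mapping.single (\<Sum>a\<in>A. f a :: 'b::comm_monoid_add) 1"
  by (induction A rule: finite_induct) (auto simp: mult_single)

lemma inj_on_perm_position:
  assumes "card R = card C" "p permutes {0..<card R}"
  shows "inj_on (\<lambda>a. (sorted_list_of_set R ! a, sorted_list_of_set C ! p a)) {..<card R}"
  by (rule inj_onI) (auto simp: nth_eq_iff_index_eq)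

lemma lookup_perm_term:
  assumes "card R = card C" "p permutes {0..<card R}"
  shows "Poly_Mapping.lookup (perm_term R C p) v =
    of_bool (v \<in> (\<lambda>a. (sorted_list_of_set R ! a, sorted_list_of_set C ! p a)) ` {..<card R})"
  unfolding perm_term_def var_term_def
  by (rule lookup_sum_single_inj[OF _ inj_on_perm_position[OF assms]]) simp

lemma keys_perm_term:
  assumes "card R = card C" "p permutes {0..<card R}"
  shows "Poly_Mapping.keys (perm_term R C p) =
    (\<lambda>a. (sorted_list_of_set R ! a, sorted_list_of_set C ! p a)) ` {..<card R}"
  by (auto simp: in_keys_iff lookup_perm_term[OF assms])

lemma card_keys_perm_term:
  assumes "card R = card C" "p permutes {0..<card R}"
  shows "card (Poly_Mapping.keys (perm_term R C p)) = card R"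
  by (simp add: keys_perm_term[OF assms] card_image[OF inj_on_perm_position[OF assms]])

lemma nth_sorted_list_image:
  fixes S :: "'a::{finite,linorder} set"
  shows "(!) (sorted_list_of_set S) ` {..<card S} = S"
  by (metis finite lessThan_atLeast0 list.set_map map_nth set_sorted_list_of_set
      set_upt sorted_list_of_set.length_sorted_key_list_of_set)

text \<open>The entries of a term of a minor determine which rows and columns the minor uses.\<close>

lemma fst_keys_perm_term:
  assumes "card R = card C" "p permutes {0..<card R}"
  shows "fst ` Poly_Mapping.keys (perm_term R C p) = R"
  using nth_sorted_list_image[of R]
  by (simp add: keys_perm_term[OF assms] image_image)

lemma snd_keys_perm_term:
  assumes "card R = card C" "p permutes {0..<card R}"
  shows "snd ` Poly_Mapping.keys (perm_term R C p) = C"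
proof -
  have "(\<lambda>a. sorted_list_of_set C ! p a) ` {..<card R} = (!) (sorted_list_of_set C) ` p ` {..<card R}"
    by (simp add: image_image)
  also have "p ` {..<card R} = {..<card C}"
    using permutes_image[OF assms(2)] assms(1) by (simp add: lessThan_atLeast0)
  finally show ?thesis
    by (simp add: keys_perm_term[OF assms] image_image nth_sorted_list_image)
qed

lemma inj_on_fst_keys_perm_term:
  assumes "card R = card C" "p permutes {0..<card R}"
  shows "inj_on fst (Poly_Mapping.keys (perm_term R C p))"
  by (rule eq_card_imp_inj_on)
    (simp_all add: fst_keys_perm_term[OF assms] card_keys_perm_term[OF assms])

lemma term_degree_perm_term:
  assumes "card R = card C" "p permutes {0..<card R}"
  shows "term_degree (perm_term R C p) = card R"
proof -
  have "term_degree (perm_term R C p) = (\<Sum>v\<in>Poly_Mapping.keys (perm_term R C p). 1)"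
    unfolding term_degree_def
    by (rule sum.cong) (auto simp: keys_perm_term[OF assms] lookup_perm_term[OF assms])
  then show ?thesis by (simp add: card_keys_perm_term[OF assms])
qed

text \<open>No two permutations contribute to the same term, so the Leibniz expansion of a generic minor
  has no cancellation.\<close>

lemma perm_term_inj:
  assumes "card R = card C" "p permutes {0..<card R}" "q permutes {0..<card R}"
    and "perm_term R C p = perm_term R C q"
  shows "p = q"
proof
  fix a
  show "p a = q a"
  proof (cases "a < card R")
    case True
    have "(sorted_list_of_set R ! a, sorted_list_of_set C ! p a) \<in> Poly_Mapping.keys (perm_term R C q)"
      using True assms(4) keys_perm_term[OF assms(1,2)] by auto
    then obtain b where b: "b < card R" "sorted_list_of_set R ! a = sorted_list_of_set R ! b"
      "sorted_list_of_set C ! p a = sorted_list_of_set C ! q b"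
      using keys_perm_term[OF assms(1,3)] by auto
    have "a = b" using b True by (simp add: nth_eq_iff_index_eq)
    moreover have "p a < card C" "q b < card C"
      using permutes_in_image[OF assms(2), of a] permutes_in_image[OF assms(3), of b] True b assms(1) by auto
    ultimately show ?thesis using b by (simp add: nth_eq_iff_index_eq)
  next
    case False
    then show ?thesis using permutes_not_in[OF assms(2)] permutes_not_in[OF assms(3)] by simp
  qed
qed

section \<open>Terms and degree of a minor\<close>

lemma minor_expansion:
  assumes "card R = card C"
  shows "(minor R C :: ('m::{finite,linorder}, 'n::{finite,linorder}, 'k::field) gpoly) =
    (\<Sum>p | p permutes {0..<card R}. Poly_Mapping.single (perm_term R C p) (of_int (sign p)))"
proof -
  have entry: "(\<Prod>a=0..<card R. mat (card R) (card C)
        (\<lambda>(a, b). var (sorted_list_of_set R ! a) (sorted_list_of_set C ! b)) $$ (a, p a)) =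
      (Poly_Mapping.single (perm_term R C p) 1 :: ('m, 'n, 'k) gpoly)"
    if p: "p permutes {0..<card R}" for p
  proof -
    have "p a < card C" if "a < card R" for a
      using permutes_in_image[OF p, of a] that assms by simp
    then have "(\<Prod>a=0..<card R. mat (card R) (card C)
        (\<lambda>(a, b). var (sorted_list_of_set R ! a) (sorted_list_of_set C ! b)) $$ (a, p a)) =
      (\<Prod>a=0..<card R. Poly_Mapping.single
        (var_term (sorted_list_of_set R ! a) (sorted_list_of_set C ! p a)) (1::'k))"
      by (intro prod.cong) (auto simp: var_def)
    then show ?thesis
      by (simp add: prod_single_one perm_term_def lessThan_atLeast0)
  qed
  have sgn: "signof p * Poly_Mapping.single t 1 = (Poly_Mapping.single t (of_int (sign p)) :: ('m, 'n, 'k) gpoly)"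
    for p t by (cases "evenperm p") (simp_all add: sign_def single_uminus)
  show ?thesis
    unfolding minor_def det_def using assms entry sgn
    by (auto intro!: sum.cong)
qed

lemma terms_minor_subset:
  assumes "card R = card C" "t \<in> terms (minor R C :: ('m::{finite,linorder}, 'n::{finite,linorder}, 'k::field) gpoly)"
  obtains p where "p permutes {0..<card R}" "t = perm_term R C p"
proof -
  have "Poly_Mapping.lookup (minor R C :: ('m, 'n, 'k) gpoly) t \<noteq> 0"
    using assms(2) by (simp add: terms_def in_keys_iff)
  then have "\<exists>p\<in>{p. p permutes {0..<card R}}.
      Poly_Mapping.lookup (Poly_Mapping.single (perm_term R C p) (of_int (sign p)) :: ('m, 'n, 'k) gpoly) t \<noteq> 0"
    unfolding minor_expansion[OF assms(1)] lookup_sum by (meson sum.neutral)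
  with that show ?thesis by (auto simp: lookup_single when_def split: if_splits)
qed

lemma lookup_minor_diag_term:
  assumes "card R = card C"
  shows "Poly_Mapping.lookup (minor R C :: ('m::{finite,linorder}, 'n::{finite,linorder}, 'k::field) gpoly)
     (diag_term R C) = 1"
proof -
  let ?P = "{p. p permutes {0..<card R}}"
  have "Poly_Mapping.lookup (minor R C :: ('m, 'n, 'k) gpoly) (diag_term R C) =
      (\<Sum>p\<in>?P. if p = id then of_int (sign p) else 0)"
    unfolding minor_expansion[OF assms] lookup_sum diag_term_eq_perm_term_id
    by (rule sum.cong)
      (auto simp: lookup_single when_def dest: perm_term_inj[OF assms _ permutes_id])
  also have "\<dots> = 1"
    by (subst sum.delta) (auto simp: finite_permutations)
  finally show ?thesis .
qed

lemma diag_term_in_terms_minor: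
  assumes "card R = card C"
  shows "diag_term R C \<in> terms (minor R C :: ('m::{finite,linorder}, 'n::{finite,linorder}, 'k::field) gpoly)"
  using lookup_minor_diag_term[OF assms, where 'k='k] by (simp add: terms_def in_keys_iff)

lemma total_degree_minor:
  assumes "card R = card C"
  shows "total_degree (minor R C :: ('m::{finite,linorder}, 'n::{finite,linorder}, 'k::field) gpoly) = card R"
proof -
  let ?T = "terms (minor R C :: ('m, 'n, 'k) gpoly)"
  have "term_degree t = card R" if t: "t \<in> ?T" for t
  proof -
    obtain p where "p permutes {0..<card R}" "t = perm_term R C p"
      using terms_minor_subset[OF assms t] .
    then show ?thesis by (simp add: term_degree_perm_term[OF assms])
  qed
  then have "term_degree ` ?T = (\<lambda>_. card R) ` ?T"
    by (rule image_cong[OF refl])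
  also have "\<dots> = {card R}"
    using diag_term_in_terms_minor[OF assms, where 'k='k] by (rule image_constant)
  finally have "term_degree ` ?T = {card R}" .
  then show ?thesis by (simp add: total_degree_def)
qed

section \<open>Chains bound the diagonal length from below\<close>

lemma longest_increasing_ge:
  assumes "ys \<in> set (subseqs xs)" "sorted_wrt (<) ys"
  shows "length ys \<le> longest_increasing xs"
  unfolding longest_increasing_def using assms by (intro Max_ge) (auto simp del: in_set_subseqs)

text \<open>Stated inside the class because an interpretation of \<open>folding_insort_key\<close> at a concrete
  type yields facts about \<open>linorder.sorted_key_list_of_set (\<le>)\<close>, which does not unfold to the
  class constant \<open>sorted_key_list_of_set\<close> by itself.\<close>

lemma (in linorder) set_and_strict_sorted_sorted_key_list_of_set:
  assumes "inj_on f A" "finite A"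
  shows "set (sorted_key_list_of_set f A) = A"
    and "sorted_wrt (<) (map f (sorted_key_list_of_set f A))"
proof -
  interpret folding_insort_key "(\<le>)" "(<)" A f
    by unfold_locales (rule assms(1))
  show "set (sorted_key_list_of_set f A) = A"
    and "sorted_wrt (<) (map f (sorted_key_list_of_set f A))"
    using assms(2) by simp_all
qed

text \<open>When \<open>t\<close> has at most one entry in each row, listing its entries in \<open>B\<close> by row is
  unambiguous, and the chain \<open>D\<close> appears in this list as a sublist whose columns increase.\<close>

lemma diagonal_length_ge_card_chain:
  assumes inj: "inj_on fst (Poly_Mapping.keys t)"
    and D: "D \<subseteq> Poly_Mapping.keys t" "D \<subseteq> B"
    and chain: "\<And>x y. x \<in> D \<Longrightarrow> y \<in> D \<Longrightarrow> fst x < fst y \<Longrightarrow> snd x < snd y"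
  shows "card D \<le> diagonal_length t B"
proof -
  let ?A = "Poly_Mapping.keys t \<inter> B"
  let ?L = "sorted_key_list_of_set fst ?A"
  let ?F = "filter (\<lambda>x. x \<in> D) ?L"
  have "inj_on fst ?A"
    using inj by (rule inj_on_subset) simp
  then have set: "set ?L = ?A" and sorted: "sorted_wrt (<) (map fst ?L)"
    by (simp_all add: set_and_strict_sorted_sorted_key_list_of_set)
  have dist: "distinct ?L"
    using sorted by (simp add: strict_sorted_iff distinct_map)
  have "sorted_wrt (\<lambda>x y. fst x < fst y) ?F"
    using sorted by (auto simp: sorted_wrt_map intro: sorted_wrt_filter)
  then have "sorted_wrt (\<lambda>x y. snd x < snd y) ?F"
    by (rule sorted_wrt_mono_rel[rotated]) (auto intro: chain)
  then have "sorted_wrt (<) (map snd ?F)"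
    by (simp add: sorted_wrt_map)
  moreover have "map snd ?F \<in> set (subseqs (map snd ?L))"
    unfolding in_set_subseqs by (rule subseq_map[OF subseq_filter_left])
  ultimately have "length (map snd ?F) \<le> diagonal_length t B"
    unfolding diagonal_length_def by (rule longest_increasing_ge[rotated])
  moreover have "set ?F = D"
    using D set by auto
  then have "length ?F = card D"
    using dist distinct_card[of ?F] by simp
  ultimately show ?thesis by simp
qed

section \<open>Diagonal terms dividing terms of a minor\<close>

lemma diag_term_keys_chain:
  assumes "card R = card C"
    and "x \<in> Poly_Mapping.keys (diag_term R C)" "y \<in> Poly_Mapping.keys (diag_term R C)"
    and "fst x < fst y"
  shows "snd x < snd y"
proof -
  obtain a b where ab: "a < card R" "b < card R"
      "x = (sorted_list_of_set R ! a, sorted_list_of_set C ! a)"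
      "y = (sorted_list_of_set R ! b, sorted_list_of_set C ! b)"
    using assms(2,3)
    by (auto simp: diag_term_eq_perm_term_id keys_perm_term[OF assms(1) permutes_id])
  have "a < b"
  proof (rule ccontr)
    assume "\<not> a < b"
    then have "sorted_list_of_set R ! b \<le> sorted_list_of_set R ! a"
      using ab by (intro sorted_nth_mono) auto
    with assms(4) ab show False by simp
  qed
  then show ?thesis
    using ab assms(1) sorted_wrt_nth_less[OF strict_sorted_list_of_set[of C], of a b] by simp
qed

lemma tdvd_imp_keys_subset:
  assumes "tdvd s t"
  shows "Poly_Mapping.keys s \<subseteq> Poly_Mapping.keys t"
  using assms by (auto simp: tdvd_def in_keys_iff lookup_add)

text \<open>The diagonal of \<open>R' \<times> C'\<close> is itself the chain that witnesses the diagonal length.\<close>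

lemma card_le_diagonal_length_if_diag_term_dvd:
  fixes R :: "'m::{finite,linorder} set" and C :: "'n::{finite,linorder} set"
  assumes "card R = card C" "card R' = card C'" "R' \<times> C' \<subseteq> B"
    and "t \<in> terms (minor R C :: ('m, 'n, 'k::field) gpoly)"
    and "tdvd (diag_term R' C') t"
  shows "card R' \<le> diagonal_length t B"
proof -
  obtain p where p: "p permutes {0..<card R}" "t = perm_term R C p"
    using terms_minor_subset[OF assms(1,4)] .
  let ?D = "Poly_Mapping.keys (diag_term R' C')"
  have "?D \<subseteq> fst ` ?D \<times> snd ` ?D"
    by force
  also have "\<dots> = R' \<times> C'"
    by (simp add: diag_term_eq_perm_term_id
        fst_keys_perm_term[OF assms(2)] snd_keys_perm_term[OF assms(2)])
  finally have "?D \<subseteq> B" using assms(3) by simp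
  then have "card ?D \<le> diagonal_length t B"
    using inj_on_fst_keys_perm_term[OF assms(1) p(1)] tdvd_imp_keys_subset[OF assms(5)]
    by (intro diagonal_length_ge_card_chain diag_term_keys_chain[OF assms(2)]) (simp_all add: p(2))
  then show ?thesis
    by (simp add: diag_term_eq_perm_term_id card_keys_perm_term[OF assms(2)])
qed

text \<open>For minors of equal size, divisibility of these squarefree terms of equal degree forces them to
  have the same entries, and a set of entries remembers its rows and columns.\<close>

lemma rows_cols_eq_if_diag_term_dvd:
  fixes R :: "'m::{finite,linorder} set" and C :: "'n::{finite,linorder} set"
  assumes "card R = card C" "card R' = card C'" "card R' = card R"
    and "t \<in> terms (minor R C :: ('m, 'n, 'k::field) gpoly)"
    and "tdvd (diag_term R' C') t"
  shows "R' = R" "C' = C"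
proof -
  obtain p where p: "p permutes {0..<card R}" "t = perm_term R C p"
    using terms_minor_subset[OF assms(1,4)] .
  have "Poly_Mapping.keys (perm_term R' C' id) = Poly_Mapping.keys (perm_term R C p)"
    using tdvd_imp_keys_subset[OF assms(5)]
    by (intro card_subset_eq)
      (simp_all add: p diag_term_eq_perm_term_id card_keys_perm_term[OF assms(1)]
        card_keys_perm_term[OF assms(2)] assms(3))
  then show "R' = R" "C' = C"
    using fst_keys_perm_term[OF assms(1) p(1)] fst_keys_perm_term[OF assms(2) permutes_id]
      snd_keys_perm_term[OF assms(1) p(1)] snd_keys_perm_term[OF assms(2) permutes_id]
    by metis+
qed

section \<open>Minimality and reducedness\<close>

text \<open>Both parts of the theorem are instances of this lemma. The bound on the diagonal length is
  imposed on the single term \<open>t\<close>, so that \<open>t\<close> may be the leading term or any other one.\<close>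

lemma lt_not_dvd_term_of_minor:
  fixes g h :: "('m::{finite,linorder}, 'n::{finite,linorder}, 'k::field) gpoly"
  assumes "diagonal_term_order TYPE('k) tle"
    and "g \<in> bdi_gens k B r" "h \<in> bdi_gens k B r" "h \<noteq> g" "t \<in> terms g"
    and short: "\<And>j. j < k \<Longrightarrow> r j \<noteq> total_degree g \<Longrightarrow> diagonal_length t (B j) < r j"
  shows "\<not> tdvd (lt tle h) t"
proof
  assume dvd: "tdvd (lt tle h) t"
  obtain R C where g: "g = minor R C" "card R = card C"
    using assms(2) by (auto simp: bdi_gens_def minors_in_def)
  obtain j R' C' where h: "h = minor R' C'" "j < k" "card R' = r j" "card C' = r j" "R' \<times> C' \<subseteq> B j"
    using assms(3) by (auto simp: bdi_gens_def minors_in_def)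
  have dvd': "tdvd (diag_term R' C') t"
    using dvd assms(1) h by (simp add: diagonal_term_order_def)
  have t: "t \<in> terms (minor R C :: ('m, 'n, 'k) gpoly)"
    using assms(5) g by simp
  show False
  proof (cases "r j = card R")
    case True
    have "card R' = card C'" "card R' = card R"
      using h(3,4) True by argo+
    from rows_cols_eq_if_diag_term_dvd[OF g(2) this t dvd'] show False
      using h(1) g(1) assms(4) by metis
  next
    case False
    then have "diagonal_length t (B j) < r j"
      using short h(2) total_degree_minor[OF g(2), where 'k='k] g(1) by simp
    moreover have "r j \<le> diagonal_length t (B j)"
      using card_le_diagonal_length_if_diag_term_dvd[OF g(2) _ h(5) t dvd'] h(3,4) by simp
    ultimately show False by simp
  qed
qed

lemma lt_in_terms_and_lc_of_generator:
  fixes g :: "('m::{finite,linorder}, 'n::{finite,linorder}, 'k::field) gpoly"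
  assumes "diagonal_term_order TYPE('k) tle" "g \<in> bdi_gens k B r"
  shows "lt tle g \<in> terms g" "lc tle g = 1"
proof -
  obtain R C where "g = minor R C" "card R = card C"
    using assms(2) by (auto simp: bdi_gens_def minors_in_def)
  then show "lt tle g \<in> terms g" "lc tle g = 1"
    using assms(1) diag_term_in_terms_minor[of R C, where 'k='k]
      lookup_minor_diag_term[of R C, where 'k='k]
    by (simp_all add: diagonal_term_order_def lc_def)
qed

theorem proposition4p6:
  fixes k :: nat
    and B :: "nat \<Rightarrow> ('m::{finite,linorder} \<times> 'n::{finite,linorder}) set"
    and r :: "nat \<Rightarrow> nat"
    and tle :: "('m, 'n) mterm \<Rightarrow> ('m, 'n) mterm \<Rightarrow> bool"
    and G :: "('m, 'n, 'k::field) gpoly set"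
  assumes "CARD('m) \<le> CARD('n)"
    and "\<And>i. i < k \<Longrightarrow> diagonal_block (B i)"
    and "\<And>i. i < k \<Longrightarrow> 0 < r i"
    and "G = bdi_gens k B r"
    and "diagonal_term_order TYPE('k) tle"
    and "groebner_basis tle (bdi k B r) G"
  shows "((\<forall>m\<in>G. \<forall>j<k. r j \<noteq> total_degree m \<longrightarrow>
              diagonal_length (lt tle m) (B j) < r j)
          \<longrightarrow> minimal_groebner_basis tle (bdi k B r) G)
       \<and> ((\<forall>m\<in>G. \<forall>t\<in>terms m. \<forall>j<k. r j \<noteq> total_degree m \<longrightarrow>
              diagonal_length t (B j) < r j)
          \<longrightarrow> reduced_groebner_basis tle (bdi k B r) G)"
proof (intro conjI impI)
  note order = \<open>diagonal_term_order TYPE('k) tle\<close>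
  assume short: "\<forall>m\<in>G. \<forall>j<k. r j \<noteq> total_degree m \<longrightarrow> diagonal_length (lt tle m) (B j) < r j"
  have "\<not> tdvd (lt tle h) (lt tle g)" if "g \<in> G" "h \<in> G - {g}" for g h
    using that short lt_in_terms_and_lc_of_generator(1)[OF order, of g k B r] \<open>G = bdi_gens k B r\<close>
    by (intro lt_not_dvd_term_of_minor[OF order, of g k B r]) auto
  then show "minimal_groebner_basis tle (bdi k B r) G"
    using assms(4,6) lt_in_terms_and_lc_of_generator(2)[OF order]
    by (auto simp: minimal_groebner_basis_def)
next
  note order = \<open>diagonal_term_order TYPE('k) tle\<close>
  assume short: "\<forall>m\<in>G. \<forall>t\<in>terms m. \<forall>j<k. r j \<noteq> total_degree m \<longrightarrow> diagonal_length t (B j) < r j"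
  have "\<not> tdvd (lt tle h) t" if "g \<in> G" "t \<in> terms g" "h \<in> G - {g}" for g h t
    using that short \<open>G = bdi_gens k B r\<close>
    by (intro lt_not_dvd_term_of_minor[OF order, of g k B r]) auto
  then show "reduced_groebner_basis tle (bdi k B r) G"
    using assms(4,6) lt_in_terms_and_lc_of_generator(2)[OF order]
    by (auto simp: reduced_groebner_basis_def)
qed

end
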